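(* Let $\mathcal H=V_0\oplus V_1$ be a vector space with a fixed isomorphism $\psi:V_0\to V_1$. Let $\mathscr P_1,\mathscr P_2,\mathscr Q_1,\mathscr Q_2\subset\mathcal H$ be the graphs of linear operators $P_1,P_2,Q_1,Q_2:V_0\to V_1$, and put $P_i'=\psi^{-1}\circ P_i$, $Q_i'=\psi^{-1}\circ Q_i$ (operators $V_0\to V_0$). Let $$p_1=\begin{pmatrix}1\\ P_1'\end{pmatrix},\quad p_2=\begin{pmatrix}1\\ P_2'\end{pmatrix},\quad q_1=\begin{pmatrix}1\\ Q_1'\end{pmatrix},\quad q_2=\begin{pmatrix}1\\ Q_2'\end{pmatrix},$$ where $1$ is the identity operator of $V_0$. If the operator cross-ratio $\mathrm{DV}(\mathscr Q_2,\mathscr P_2,\mathscr Q_1,\mathscr P_1)$ and the noncommutative cross-ratio $\kappa(p_1,p_2,q_1,q_2)$ exist, then $$\mathrm{DV}(\mathscr Q_2,\mathscr P_2,\mathscr Q_1,\mathscr P_1)=\kappa(p_1,p_2,q_1,q_2).$$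
   Context: For four subspaces $\mathscr X_1,\mathscr X_2,\mathscr Y_1,\mathscr Y_2$ of $\mathcal H$ that are graphs of operators $X_1,X_2,Y_1,Y_2:V_0\to V_1$ with $X_1-X_2$ and $Y_1-Y_2$ invertible, the operator cross-ratio is $$\mathrm{DV}(\mathscr X_1,\mathscr X_2,\mathscr Y_1,\mathscr Y_2)=(X_1-X_2)^{-1}(X_2-Y_1)(Y_1-Y_2)^{-1}(Y_2-X_1):V_0\to V_0 .$$ For an associative unital ring $\mathcal R$ (here $\mathcal R=\mathrm{End}(V_0)$) and columns $a=(a_1,a_2)^T$, $b$, $c$, $d$ in $\mathcal R^{\oplus 2}$, write $$\begin{vmatrix}b_1&\boxed{d_1}\\ b_2&d_2\end{vmatrix}=d_1-b_1b_2^{-1}d_2$$ (defined if $b_2$ is invertible). The noncommutative cross-ratio is $$\kappa(a,b,c,d)=\begin{vmatrix}b_1&\boxed{d_1}\\ b_2&d_2\end{vmatrix}^{-1}\begin{vmatrix}b_1&\boxed{c_1}\\ b_2&c_2\end{vmatrix}\begin{vmatrix}a_1&\boxed{c_1}\\ a_2&c_2\end{vmatrix}^{-1}\begin{vmatrix}a_1&\boxed{d_1}\\ a_2&d_2\end{vmatrix},$$ and is said to exist if $a_2,b_2$ are invertible and the two quasideterminants being inverted are invertible. *)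

theory Defs
  imports Complex_Main "HOL-Algebra.Ring"
begin

(* The ambient space V0 \<oplus> V1 is the product type 'a \<times> 'b. The vector space structures
   of V0 and V1 over an arbitrary field are given by the scalar multiplications s0 and s1. *)

definition op_graph :: "('a \<Rightarrow> 'b) \<Rightarrow> ('a \<times> 'b) set" where
  "op_graph f = {(x, f x) | x. True}"

definition is_linear_graph ::
  "('k::field \<Rightarrow> 'a::ab_group_add \<Rightarrow> 'a) \<Rightarrow> ('k \<Rightarrow> 'b::ab_group_add \<Rightarrow> 'b) \<Rightarrow> ('a \<times> 'b) set \<Rightarrow> bool"
where
  "is_linear_graph s0 s1 X \<longleftrightarrow> (\<exists>f. Vector_Spaces.linear s0 s1 f \<and> X = op_graph f)"

definition graph_op :: "('a \<times> 'b) set \<Rightarrow> 'a \<Rightarrow> 'b" where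
  "graph_op X = (THE f. X = op_graph f)"

lemma op_graph_inject: "op_graph f = op_graph g \<longleftrightarrow> f = g"
  by (auto simp: op_graph_def set_eq_iff fun_eq_iff)

lemma graph_op_op_graph [simp]: "graph_op (op_graph f) = f"
  unfolding graph_op_def by (rule the_equality) (auto simp: op_graph_inject)

(* Subtraction of operators is the pointwise difference (class instance of minus on
   functions). A linear map is invertible iff it is bijective, and inv_into UNIV is then its inverse. *)

definition DV_exists ::
  "('k::field \<Rightarrow> 'a::ab_group_add \<Rightarrow> 'a) \<Rightarrow> ('k \<Rightarrow> 'b::ab_group_add \<Rightarrow> 'b) \<Rightarrow>
   ('a \<times> 'b) set \<Rightarrow> ('a \<times> 'b) set \<Rightarrow> ('a \<times> 'b) set \<Rightarrow> ('a \<times> 'b) set \<Rightarrow> bool"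
where
  "DV_exists s0 s1 X1 X2 Y1 Y2 \<longleftrightarrow>
     is_linear_graph s0 s1 X1 \<and> is_linear_graph s0 s1 X2 \<and>
     is_linear_graph s0 s1 Y1 \<and> is_linear_graph s0 s1 Y2 \<and>
     bij (graph_op X1 - graph_op X2) \<and> bij (graph_op Y1 - graph_op Y2)"

definition DV ::
  "('a \<times> 'b::ab_group_add) set \<Rightarrow> ('a \<times> 'b) set \<Rightarrow> ('a \<times> 'b) set \<Rightarrow> ('a \<times> 'b) set \<Rightarrow> 'a \<Rightarrow> 'a"
where
  "DV X1 X2 Y1 Y2 =
     inv_into UNIV (graph_op X1 - graph_op X2) \<circ> (graph_op X2 - graph_op Y1) \<circ>
     inv_into UNIV (graph_op Y1 - graph_op Y2) \<circ> (graph_op Y2 - graph_op X1)"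

definition End_ring :: "('k::field \<Rightarrow> 'a::ab_group_add \<Rightarrow> 'a) \<Rightarrow> ('a \<Rightarrow> 'a) ring" where
  "End_ring s =
     \<lparr>carrier = {f. Vector_Spaces.linear s s f}, mult = (\<circ>), one = id,
      zero = (\<lambda>_. 0), add = (\<lambda>f g x. f x + g x)\<rparr>"

lemma ring_End_ring:
  fixes s :: "'k::field \<Rightarrow> 'a::ab_group_add \<Rightarrow> 'a"
  assumes "vector_space s"
  shows "ring (End_ring s)"
proof -
  interpret vector_space_pair s s
    using assms by (simp add: vector_space_pair_def)
  have neg: "\<exists>g. Vector_Spaces.linear s s g \<and> (\<lambda>x. f x + g x) = (\<lambda>_. 0)"
    if "Vector_Spaces.linear s s f" for f
    by (rule exI[of _ "\<lambda>x. - f x"]) (use that linear_compose_neg in auto)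
  show ?thesis
  proof (rule ringI)
    show "abelian_group (End_ring s)"
      by (rule abelian_groupI)
         (auto simp: End_ring_def linear_compose_add linear_0 module_hom_zero
            algebra_simps intro!: neg)
    show "monoid (End_ring s)"
      by (rule monoidI)
         (auto simp: End_ring_def vs1.linear_id o_assoc intro: Vector_Spaces.linear_compose)
  qed (auto simp: End_ring_def fun_eq_iff linear_add)
qed

(* The quasideterminant of the matrix with columns b, d, with the upper right entry boxed.
   Columns (u1, u2) are pairs. The value is meaningful only if snd b is a unit of R. *)

definition quasidet :: "('r, 'm) ring_scheme \<Rightarrow> 'r \<times> 'r \<Rightarrow> 'r \<times> 'r \<Rightarrow> 'r" where
  "quasidet R b d = fst d \<ominus>\<^bsub>R\<^esub> fst b \<otimes>\<^bsub>R\<^esub> inv\<^bsub>R\<^esub> (snd b) \<otimes>\<^bsub>R\<^esub> snd d"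

definition kappa_exists ::
  "('r, 'm) ring_scheme \<Rightarrow> 'r \<times> 'r \<Rightarrow> 'r \<times> 'r \<Rightarrow> 'r \<times> 'r \<Rightarrow> 'r \<times> 'r \<Rightarrow> bool"
where
  "kappa_exists R a b c d \<longleftrightarrow>
     {a, b, c, d} \<subseteq> carrier R \<times> carrier R \<and>
     snd a \<in> Units R \<and> snd b \<in> Units R \<and>
     quasidet R b d \<in> Units R \<and> quasidet R a c \<in> Units R"

definition kappa ::
  "('r, 'm) ring_scheme \<Rightarrow> 'r \<times> 'r \<Rightarrow> 'r \<times> 'r \<Rightarrow> 'r \<times> 'r \<Rightarrow> 'r \<times> 'r \<Rightarrow> 'r"
where
  "kappa R a b c d =
     inv\<^bsub>R\<^esub> (quasidet R b d) \<otimes>\<^bsub>R\<^esub> quasidet R b c \<otimes>\<^bsub>R\<^esub>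
     inv\<^bsub>R\<^esub> (quasidet R a c) \<otimes>\<^bsub>R\<^esub> quasidet R a d"

end

theory Submission
  imports Defs
begin

text \<open>Writing \<open>\<psi>\<^sup>-\<^sup>1 P\<close> as \<open>x\<close> and \<open>\<psi>\<^sup>-\<^sup>1 Q\<close> as \<open>y\<close>, each quasideterminant is
  \<open>1 - x\<^sup>-\<^sup>1 y = x\<^sup>-\<^sup>1 (x - y)\<close>. In \<open>\<kappa>\<close> the factors \<open>x\<^sup>-\<^sup>1\<close> cancel in pairs, and so do the two sign
  changes that turn \<open>x - y\<close> into \<open>y - x\<close> in the inverted factors. In \<open>DV\<close> every difference of
  operators is \<open>\<psi>\<close> composed with a difference of endomorphisms, and the \<open>\<psi>\<close> cancel likewise.\<close>

lemma (in ring) quasidet_one: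
  assumes x: "x \<in> Units R" and y: "y \<in> carrier R"
  shows "quasidet R (\<one>, x) (\<one>, y) = inv x \<otimes> (x \<ominus> y)"
  using assms Units_closed[OF x] Units_inv_closed[OF x] Units_l_inv[OF x]
  by (simp add: quasidet_def a_minus_def r_distr r_minus)

text \<open>Since \<open>y \<ominus> x = \<ominus> (x \<ominus> y)\<close>, the negated inverse of
  \<open>x \<ominus> y\<close> is a two-sided inverse of \<open>y \<ominus> x\<close>. In
  \<open>kappa_one\<close> this reverses both inverted differences at the cost of one sign
  each.\<close>

lemma (in ring) Units_minus_swap:
  assumes "x \<in> carrier R" "y \<in> carrier R" "x \<ominus> y \<in> Units R"
  shows "y \<ominus> x \<in> Units R" and "inv (x \<ominus> y) = \<ominus> (inv (y \<ominus> x))"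
proof -
  have eq: "y \<ominus> x = \<ominus> (x \<ominus> y)"
    using assms by (simp add: a_minus_def minus_add a_comm)
  have c: "x \<ominus> y \<in> carrier R" "inv (x \<ominus> y) \<in> carrier R"
    using assms by auto
  have prods: "(\<ominus> (inv (x \<ominus> y))) \<otimes> (y \<ominus> x) = \<one>" "(y \<ominus> x) \<otimes> (\<ominus> (inv (x \<ominus> y))) = \<one>"
    unfolding eq using c assms(3) by (simp_all add: l_minus r_minus)
  have cl: "y \<ominus> x \<in> carrier R" "\<ominus> (inv (x \<ominus> y)) \<in> carrier R"
    using assms c by auto
  show "y \<ominus> x \<in> Units R"
    unfolding Units_def using cl prods by blast
  have "inv (y \<ominus> x) = \<ominus> (inv (x \<ominus> y))"
    using inv_char[OF cl prods(2,1)] .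
  then show "inv (x \<ominus> y) = \<ominus> (inv (y \<ominus> x))"
    using c by simp
qed

text \<open>The inverse of \<open>inv x \<otimes> u\<close> is \<open>inv u \<otimes> x\<close>,
  whose last factor meets the following \<open>inv x\<close>.\<close>

lemma (in monoid) mult_inv_mult_cancel:
  assumes "x \<in> Units G" "u \<in> Units G" "v \<in> carrier G"
  shows "inv (inv x \<otimes> u) \<otimes> (inv x \<otimes> v) = inv u \<otimes> v"
proof -
  have c: "x \<in> carrier G" "inv x \<in> carrier G" "u \<in> carrier G" "inv u \<in> carrier G"
    using assms by auto
  have cancel: "x \<otimes> (inv x \<otimes> w) = w" "u \<otimes> (inv u \<otimes> w) = w" "inv u \<otimes> (u \<otimes> w) = w"
    if "w \<in> carrier G" for w
    using that assms c by (simp_all add: m_assoc[symmetric])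
  have "inv (inv x \<otimes> u) = inv u \<otimes> x"
    by (rule inv_char) (use assms c in \<open>simp_all add: m_assoc cancel\<close>)
  then show ?thesis
    using assms c by (simp add: m_assoc cancel)
qed

text \<open>The right-hand side has the same pattern of differences as \<open>DV\<close>, already
  over an arbitrary ring. The two unit claims later allow the ring inverses to be read as inverse
  functions.\<close>

lemma (in ring) kappa_one:
  assumes ex: "kappa_exists R (\<one>, x1) (\<one>, x2) (\<one>, y1) (\<one>, y2)"
  shows "y2 \<ominus> x2 \<in> Units R" and "y1 \<ominus> x1 \<in> Units R"
    and "kappa R (\<one>, x1) (\<one>, x2) (\<one>, y1) (\<one>, y2) =
      inv (y2 \<ominus> x2) \<otimes> (x2 \<ominus> y1) \<otimes> inv (y1 \<ominus> x1) \<otimes> (x1 \<ominus> y2)"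
proof -
  have x: "x1 \<in> Units R" "x2 \<in> Units R" and y: "y1 \<in> carrier R" "y2 \<in> carrier R"
    using ex by (auto simp: kappa_exists_def)
  have xc: "x1 \<in> carrier R" "x2 \<in> carrier R"
    using x by auto
  \<comment> \<open>Existence of \<open>kappa\<close> makes the whole quasideterminant a unit;
    multiplying it on the left by the unit \<open>x\<close> recovers the difference.\<close>
  have unit: "x \<ominus> y \<in> Units R"
    if "x \<in> Units R" "y \<in> carrier R" "inv x \<otimes> (x \<ominus> y) \<in> Units R" for x y
  proof -
    have "x \<otimes> (inv x \<otimes> (x \<ominus> y)) \<in> Units R"
      using that by blast
    then show ?thesis
      using that Units_closed[OF that(1)] Units_inv_closed[OF that(1)] Units_r_inv[OF that(1)]
      by (simp add: m_assoc[symmetric])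
  qed
  have u: "x2 \<ominus> y2 \<in> Units R" "x1 \<ominus> y1 \<in> Units R"
    using ex x y by (auto simp: kappa_exists_def quasidet_one intro!: unit)
  show u': "y2 \<ominus> x2 \<in> Units R" "y1 \<ominus> x1 \<in> Units R"
    using u xc y by (simp_all add: Units_minus_swap)
  let ?i = "inv (inv x2 \<otimes> (x2 \<ominus> y2))" and ?j = "inv (inv x1 \<otimes> (x1 \<ominus> y1))"
  have ij: "?i \<in> carrier R" "?j \<in> carrier R"
    using x u by auto
  \<comment> \<open>Each inverted quasideterminant is grouped with its right neighbour, which has
    the same first column and hence the same left factor \<open>inv x2\<close> or
    \<open>inv x1\<close>.\<close>
  have "kappa R (\<one>, x1) (\<one>, x2) (\<one>, y1) (\<one>, y2) =
      (?i \<otimes> (inv x2 \<otimes> (x2 \<ominus> y1))) \<otimes> (?j \<otimes> (inv x1 \<otimes> (x1 \<ominus> y2)))"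
    using x y xc ij by (simp add: kappa_def quasidet_one m_assoc)
  also have "\<dots> = (inv (x2 \<ominus> y2) \<otimes> (x2 \<ominus> y1)) \<otimes> (inv (x1 \<ominus> y1) \<otimes> (x1 \<ominus> y2))"
    using x y xc u by (simp add: mult_inv_mult_cancel)
  also have "\<dots> = inv (y2 \<ominus> x2) \<otimes> (x2 \<ominus> y1) \<otimes> inv (y1 \<ominus> x1) \<otimes> (x1 \<ominus> y2)"
    using y xc u u' by (simp add: Units_minus_swap(2)[of x2 y2] Units_minus_swap(2)[of x1 y1]
        l_minus r_minus m_assoc)
  finally show "kappa R (\<one>, x1) (\<one>, x2) (\<one>, y1) (\<one>, y2) =
      inv (y2 \<ominus> x2) \<otimes> (x2 \<ominus> y1) \<otimes> inv (y1 \<ominus> x1) \<otimes> (x1 \<ominus> y2)" .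
qed

lemma End_ring_minus:
  fixes s :: "'k::field \<Rightarrow> 'a::ab_group_add \<Rightarrow> 'a"
  assumes "vector_space s" "f \<in> carrier (End_ring s)" "g \<in> carrier (End_ring s)"
  shows "f \<ominus>\<^bsub>End_ring s\<^esub> g = f - g"
proof -
  interpret ring "End_ring s"
    using assms(1) by (rule ring_End_ring)
  interpret vector_space_pair s s
    using assms(1) by (simp add: vector_space_pair_def)
  have lin: "(\<lambda>x. - g x) \<in> carrier (End_ring s)"
    using assms(3) by (simp add: End_ring_def linear_compose_neg)
  \<comment> \<open>The ring negation is only given abstractly; uniqueness of additive inverses
    identifies it with pointwise negation.\<close>
  have "\<ominus>\<^bsub>End_ring s\<^esub> g = (\<lambda>x. - g x)"
    by (rule minus_equality) (use assms lin in \<open>auto simp: End_ring_def\<close>)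
  then show ?thesis
    by (simp add: a_minus_def End_ring_def fun_eq_iff)
qed

text \<open>The ring multiplication is composition, so a ring inverse is a two-sided inverse
  function, and such a function is unique.\<close>

lemma End_ring_Units:
  fixes s :: "'k::field \<Rightarrow> 'a::ab_group_add \<Rightarrow> 'a"
  assumes "vector_space s" "f \<in> Units (End_ring s)"
  shows "bij f" and "inv\<^bsub>End_ring s\<^esub> f = inv_into UNIV f"
proof -
  interpret ring "End_ring s"
    using assms(1) by (rule ring_End_ring)
  have "inv\<^bsub>End_ring s\<^esub> f \<circ> f = id" "f \<circ> inv\<^bsub>End_ring s\<^esub> f = id"
    using Units_l_inv[OF assms(2)] Units_r_inv[OF assms(2)] by (simp_all add: End_ring_def)
  then show "bij f" "inv\<^bsub>End_ring s\<^esub> f = inv_into UNIV f"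
    by (simp_all add: o_bij inv_unique_comp)
qed

text \<open>Linearity moves \<psi> inside the difference, where it undoes its own inverse.\<close>

lemma linear_diff_factor:
  assumes "Vector_Spaces.linear s0 s1 \<psi>" "bij \<psi>"
  shows "F - G = \<psi> \<circ> ((inv_into UNIV \<psi> \<circ> F) - (inv_into UNIV \<psi> \<circ> G))"
proof -
  interpret Vector_Spaces.linear s0 s1 \<psi> by (rule assms)
  show ?thesis
    using assms(2) by (simp add: fun_eq_iff diff bij_is_surj surj_f_inv_f)
qed

theorem proposition5p1:
  fixes s0 :: "'k::field \<Rightarrow> 'a::ab_group_add \<Rightarrow> 'a"
    and s1 :: "'k \<Rightarrow> 'b::ab_group_add \<Rightarrow> 'b"
    and \<psi> P1 P2 Q1 Q2 :: "'a \<Rightarrow> 'b"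
    and GP1 GP2 GQ1 GQ2 :: "('a \<times> 'b) set"
    and P1' P2' Q1' Q2' :: "'a \<Rightarrow> 'a"
    and p1 p2 q1 q2 :: "('a \<Rightarrow> 'a) \<times> ('a \<Rightarrow> 'a)"
  assumes "vector_space s0" and "vector_space s1"
    and "Vector_Spaces.linear s0 s1 \<psi>" and "bij \<psi>"
    and "Vector_Spaces.linear s0 s1 P1" and "Vector_Spaces.linear s0 s1 P2"
    and "Vector_Spaces.linear s0 s1 Q1" and "Vector_Spaces.linear s0 s1 Q2"
    and "GP1 = op_graph P1" and "GP2 = op_graph P2"
    and "GQ1 = op_graph Q1" and "GQ2 = op_graph Q2"
    and "P1' = inv_into UNIV \<psi> \<circ> P1" and "P2' = inv_into UNIV \<psi> \<circ> P2"
    and "Q1' = inv_into UNIV \<psi> \<circ> Q1" and "Q2' = inv_into UNIV \<psi> \<circ> Q2"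
    and "p1 = (\<one>\<^bsub>End_ring s0\<^esub>, P1')" and "p2 = (\<one>\<^bsub>End_ring s0\<^esub>, P2')"
    and "q1 = (\<one>\<^bsub>End_ring s0\<^esub>, Q1')" and "q2 = (\<one>\<^bsub>End_ring s0\<^esub>, Q2')"
    and "DV_exists s0 s1 GQ2 GP2 GQ1 GP1"
    and "kappa_exists (End_ring s0) p1 p2 q1 q2"
  shows "DV GQ2 GP2 GQ1 GP1 = kappa (End_ring s0) p1 p2 q1 q2"
proof -
  let ?E = "End_ring s0"
  interpret ring ?E
    using assms(1) by (rule ring_End_ring)
  have ex: "kappa_exists ?E (\<one>\<^bsub>?E\<^esub>, P1') (\<one>\<^bsub>?E\<^esub>, P2') (\<one>\<^bsub>?E\<^esub>, Q1') (\<one>\<^bsub>?E\<^esub>, Q2')"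
    using assms by simp
  then have car: "P1' \<in> carrier ?E" "P2' \<in> carrier ?E" "Q1' \<in> carrier ?E" "Q2' \<in> carrier ?E"
    by (auto simp: kappa_exists_def)
  note minus = End_ring_minus[OF assms(1)]
  have units: "Q2' - P2' \<in> Units ?E" "Q1' - P1' \<in> Units ?E"
    using kappa_one(1,2)[OF ex] car by (simp_all add: minus)
  note bijs = units[THEN End_ring_Units(1)[OF assms(1)]]
  \<comment> \<open>Ring subtraction and inverse are translated first; only then is
    \<open>End_ring_def\<close> unfolded, turning the remaining products into compositions.\<close>
  have kappa: "kappa ?E p1 p2 q1 q2 =
      inv_into UNIV (Q2' - P2') \<circ> (P2' - Q1') \<circ> inv_into UNIV (Q1' - P1') \<circ> (P1' - Q2')"
    using kappa_one(3)[OF ex] car units assms(17-20)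
    by (simp add: minus End_ring_Units(2)[OF assms(1)]) (simp add: End_ring_def)
  note factor = linear_diff_factor[OF assms(3,4)]
  have diffs: "Q2 - P2 = \<psi> \<circ> (Q2' - P2')" "P2 - Q1 = \<psi> \<circ> (P2' - Q1')"
      "Q1 - P1 = \<psi> \<circ> (Q1' - P1')" "P1 - Q2 = \<psi> \<circ> (P1' - Q2')"
    unfolding assms(13-16) by (rule factor)+
  \<comment> \<open>Inverting \<open>\<psi> \<circ> A\<close> leaves
    \<open>inv_into UNIV \<psi>\<close> to the right of \<open>inv_into UNIV A\<close>, next to the
    leading \<psi> of the following difference. This happens twice in \<open>DV\<close>, once for
    each inverted factor.\<close>
  have cancel: "inv_into UNIV \<psi> \<circ> \<psi> = id"
    using assms(4) by (simp add: bij_is_inj)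
  show ?thesis
    using assms(4) bijs cancel
    by (simp add: DV_def assms(9-12) diffs kappa o_inv_distrib fun_eq_iff)
qed

end
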